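(* For every integer $n\geq 0$, \[ \overline{p}(5^{2}n)\equiv \overline{p}(5^{4}n) \pmod{5}. \]
   Context: An overpartition of a nonnegative integer $n$ is a partition of $n$ in which the first occurrence of each distinct part may be overlined. $\overline{p}(n)$ denotes the number of overpartitions of $n$, with $\overline{p}(0)=1$; equivalently $\sum_{n\ge0}\overline{p}(n)q^n=\prod_{k\ge1}\frac{1+q^k}{1-q^k}$. *)

theory Defs
  imports Main "HOL-Library.Multiset"
begin

text \<open>An overpartition of n: a partition of n (a multiset of positive parts summing to n)
  together with the set of distinct parts whose first occurrence is overlined.\<close>
definition overpartitions :: "nat \<Rightarrow> (nat multiset \<times> nat set) set" where
  "overpartitions n = {(M, S). (\<forall>k \<in># M. k > 0) \<and> sum_mset M = n \<and> S \<subseteq> set_mset M}"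

definition overpartition_count :: "nat \<Rightarrow> nat" where
  "overpartition_count n = card (overpartitions n)"

end

(* Write P for the generating function of overpartitions and theta = sum (-1)^k q^(k^2), summed
   over all integers k. Gauss's identity says P * theta = 1; here it follows from a finite identity
   in the style of Shanks, proved by telescoping. Since theta^5 is congruent to theta(q^5) mod 5,
   theta^4 = P * theta^5 gives, on exponents divisible by 5,
   sum p(5n) q^n * theta = sum (-1)^n r4(5n) q^n. As r4(5n) = r4(n) mod 5, the right-hand side is
   theta^4, hence p(5n) = (-1)^n r3(n) mod 5, and it remains to see that r3(25m) = r3(m) mod 5
   whenever 5 divides m.
   Both congruences for sums of squares are a double count with the six quaternions 1 + v of norm 5:
   multiplication by 1 + v (respectively conjugation by it) embeds the representations of n (of m)
   into those of 5n (of 25m), and every vector of the target lies in either one or all six of the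
   images. *)

theory Submission
  imports Defs "HOL-Computational_Algebra.Formal_Power_Series" "HOL-Number_Theory.Cong"
begin

unbundle fps_syntax

section \<open>Overpartitions with bounded parts\<close>

definition restricted_overpartitions :: "nat \<Rightarrow> nat \<Rightarrow> (nat multiset \<times> nat set) set" where
  "restricted_overpartitions m n = {(M, S) \<in> overpartitions n. set_mset M \<subseteq> {..m}}"

text \<open>A half step from bound \<open>m - 1\<close> to bound \<open>m\<close>: it accounts for
  the denominator of the factor (1 + q^m)/(1 - q^m), and the possible overline on \<open>m\<close>
  then supplies the numerator.\<close>

definition overline_free :: "nat \<Rightarrow> nat \<Rightarrow> (nat multiset \<times> nat set) set" where
  "overline_free m n = {(M, S) \<in> restricted_overpartitions m n. m \<notin> S}"

lemma finite_overpartitions: "finite (overpartitions n)"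
proof -
  have mset_set_bound: "M \<in> mset ` {xs. set xs \<subseteq> {..n} \<and> length xs \<le> n}"
    if "\<forall>k\<in>#M. k > 0" "sum_mset M = n" for M :: "nat multiset"
  proof -
    obtain xs where xs: "M = mset xs" by (metis ex_mset)
    have "set xs \<subseteq> {..n}"
      using that member_le_sum_list[of _ xs] by (auto simp: xs sum_mset_sum_list)
    moreover have "length xs \<le> sum_list xs" if "\<forall>k\<in>set xs. k > 0" for xs :: "nat list"
      using that by (induction xs) auto
    hence "length xs \<le> n" using that by (auto simp: xs sum_mset_sum_list)
    ultimately show ?thesis using xs by auto
  qed
  have "overpartitions n \<subseteq> mset ` {xs. set xs \<subseteq> {..n} \<and> length xs \<le> n} \<times> Pow {..n}"
  proof safe
    fix M S assume "(M, S) \<in> overpartitions n"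
    hence *: "\<forall>k\<in>#M. k > 0" "sum_mset M = n" and S: "S \<subseteq> set_mset M"
      by (auto simp: overpartitions_def)
    show M: "M \<in> mset ` {xs. set xs \<subseteq> {..n} \<and> length xs \<le> n}"
      using mset_set_bound[OF *] .
    fix x assume "x \<in> S"
    have "k \<le> n" if "k \<in># M" for k using M that by auto
    thus "x \<le> n" using S \<open>x \<in> S\<close> by blast
  qed
  thus ?thesis
    by (rule finite_subset) (auto intro!: finite_imageI finite_lists_length_le)
qed

lemma finite_restricted [simp]: "finite (restricted_overpartitions m n)" "finite (overline_free m n)"
  by (auto intro: finite_subset[OF _ finite_overpartitions[of n]]
      simp: restricted_overpartitions_def overline_free_def)

lemma restricted_overpartitions_large:
  assumes "n \<le> m" shows "restricted_overpartitions m n = overpartitions n"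
proof -
  have "set_mset M \<subseteq> {..m}" if "(M, S) \<in> overpartitions n" for M S
  proof
    fix k assume "k \<in># M"
    then obtain M' where "M = add_mset k M'" by (meson multi_member_split)
    thus "k \<in> {..m}" using that assms by (simp add: overpartitions_def)
  qed
  thus ?thesis unfolding restricted_overpartitions_def by blast
qed

lemma restricted_overpartitions_0: "restricted_overpartitions 0 n = (if n = 0 then {({#}, {})} else {})"
proof -
  have empty: "M = {#}" if "\<forall>k\<in>#M. k > 0" "set_mset M \<subseteq> {..0}" for M :: "nat multiset"
  proof (rule ccontr)
    assume "M \<noteq> {#}"
    then obtain k where "k \<in># M" by (meson multiset_nonemptyE)
    hence "k > 0" "k \<in> {..0}" using that by (blast, blast)
    thus False by simp
  qed
  have sub: "x = ({#}, {}) \<and> n = 0" if x: "x \<in> restricted_overpartitions 0 n" for x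
  proof -
    obtain M S where [simp]: "x = (M, S)" by (cases x)
    have *: "\<forall>k\<in>#M. k > 0" "set_mset M \<subseteq> {..0}" "sum_mset M = n" "S \<subseteq> set_mset M"
      using x unfolding restricted_overpartitions_def overpartitions_def by simp_all
    have "M = {#}" using *(1,2) by (rule empty)
    thus ?thesis using *(3,4) by simp
  qed
  have mem: "({#}, {}) \<in> restricted_overpartitions 0 0"
    by (simp add: restricted_overpartitions_def overpartitions_def)
  show ?thesis
  proof (cases "n = 0")
    case True
    have "restricted_overpartitions 0 0 = {({#}, {})}" using mem sub True by blast
    thus ?thesis using True by simp
  next
    case False
    thus ?thesis by (auto dest: sub)
  qed
qed

text \<open>An overline on \<open>m\<close> is stripped off together with one copy of
  \<open>m\<close>; the copies that remain are not overlined. This is the factor 1 + q^m.\<close>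

lemma card_restricted_overpartitions:
  assumes "m > 0"
  shows "card (restricted_overpartitions m n) =
    card (overline_free m n) + (if m \<le> n then card (overline_free m (n - m)) else 0)"
proof -
  let ?f = "\<lambda>(M, S). (add_mset m M, insert m S)"
  let ?R = "if m \<le> n then ?f ` overline_free m (n - m) else {}"
  have eq: "restricted_overpartitions m n = overline_free m n \<union> ?R"
  proof (intro equalityI subsetI)
    fix x assume x: "x \<in> restricted_overpartitions m n"
    obtain M S where [simp]: "x = (M, S)" by force
    show "x \<in> overline_free m n \<union> ?R"
    proof (cases "m \<in> S")
      case True
      with x have "m \<in># M" by (auto simp: restricted_overpartitions_def overpartitions_def)
      then obtain M' where M': "M = add_mset m M'" by (meson multi_member_split)
      have 1: "x = ?f (M', S - {m})" and 2: "m \<le> n" and 3: "(M', S - {m}) \<in> overline_free m (n - m)"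
        using True x by (auto simp: M' overline_free_def restricted_overpartitions_def overpartitions_def)
      from 1 3 have "x \<in> ?f ` overline_free m (n - m)" by (rule image_eqI)
      with 2 show ?thesis by simp
    qed (use x in \<open>auto simp: overline_free_def\<close>)
  next
    fix x assume "x \<in> overline_free m n \<union> ?R"
    thus "x \<in> restricted_overpartitions m n"
      using assms by (auto simp: overline_free_def restricted_overpartitions_def overpartitions_def split: if_splits)
  qed
  have inj: "inj_on ?f (overline_free m (n - m))"
    by (auto simp: inj_on_def overline_free_def)
  have "overline_free m n \<inter> ?R = {}"
    by (auto simp: overline_free_def)
  thus ?thesis
    unfolding eq using inj
    by (subst card_Un_disjoint) (auto simp: card_image)
qed

text \<open>Either \<open>m\<close> does not occur or one copy of it can be removed. The recursion
  refers to itself, which expresses the geometric series 1/(1 - q^m) without inverting a power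
  series.\<close>

lemma card_overline_free:
  assumes "m > 0"
  shows "card (overline_free m n) =
    card (restricted_overpartitions (m - 1) n) + (if m \<le> n then card (overline_free m (n - m)) else 0)"
proof -
  let ?f = "\<lambda>(M, S). (add_mset m M, S)"
  let ?R = "if m \<le> n then ?f ` overline_free m (n - m) else {}"
  have eq: "overline_free m n = restricted_overpartitions (m - 1) n \<union> ?R"
  proof (intro equalityI subsetI)
    fix x assume x: "x \<in> overline_free m n"
    obtain M S where [simp]: "x = (M, S)" by force
    show "x \<in> restricted_overpartitions (m - 1) n \<union> ?R"
    proof (cases "m \<in># M")
      case True
      then obtain M' where M': "M = add_mset m M'" by (meson multi_member_split)
      have 1: "x = ?f (M', S)" and 2: "m \<le> n" and 3: "(M', S) \<in> overline_free m (n - m)"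
        using True x by (auto simp: M' overline_free_def restricted_overpartitions_def overpartitions_def)
      from 1 3 have "x \<in> ?f ` overline_free m (n - m)" by (rule image_eqI)
      with 2 show ?thesis by simp
    next
      case False
      have "k \<le> m - 1" if "k \<in># M" for k
        using that False x
        by (cases "k = m") (force simp: overline_free_def restricted_overpartitions_def)+
      thus ?thesis using x by (auto simp: overline_free_def restricted_overpartitions_def)
    qed
  next
    fix x assume "x \<in> restricted_overpartitions (m - 1) n \<union> ?R"
    thus "x \<in> overline_free m n"
      using assms by (force simp: overline_free_def restricted_overpartitions_def overpartitions_def split: if_splits)
  qed
  have inj: "inj_on ?f (overline_free m (n - m))"
    by (auto simp: inj_on_def)
  have "restricted_overpartitions (m - 1) n \<inter> ?R = {}"
    using assms by (auto simp: restricted_overpartitions_def)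
  thus ?thesis
    unfolding eq using inj
    by (subst card_Un_disjoint) (auto simp: card_image)
qed

section \<open>Shanks's finite form of Gauss's identity\<close>

definition restricted_fps :: "nat \<Rightarrow> int fps" where
  "restricted_fps m = Abs_fps (\<lambda>n. int (card (restricted_overpartitions m n)))"

definition overline_free_fps :: "nat \<Rightarrow> int fps" where
  "overline_free_fps m = Abs_fps (\<lambda>n. int (card (overline_free m n)))"

lemma restricted_fps_0: "restricted_fps 0 = 1"
  by (rule fps_ext) (simp add: restricted_fps_def restricted_overpartitions_0)

lemma restricted_fps_eq: "m > 0 \<Longrightarrow> restricted_fps m = (1 + fps_X ^ m) * overline_free_fps m"
  by (rule fps_ext)
    (simp add: restricted_fps_def overline_free_fps_def card_restricted_overpartitions
      distrib_right fps_X_power_mult_nth)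

lemma overline_free_fps_eq: "m > 0 \<Longrightarrow> (1 - fps_X ^ m) * overline_free_fps m = restricted_fps (m - 1)"
  by (rule fps_ext, subst left_diff_distrib)
    (simp add: restricted_fps_def overline_free_fps_def card_overline_free fps_X_power_mult_nth)

definition theta_trunc :: "nat \<Rightarrow> int fps" where
  "theta_trunc n = (\<Sum>k\<in>{- int n..int n}. (- 1) ^ nat \<bar>k\<bar> * fps_X ^ nat (k\<^sup>2))"

lemma theta_trunc_0: "theta_trunc 0 = 1"
  by (simp add: theta_trunc_def)

lemma theta_trunc_Suc:
  "theta_trunc (Suc n) = theta_trunc n + 2 * (- 1) ^ Suc n * fps_X ^ (Suc n)\<^sup>2"
proof -
  have "{- int (Suc n)..int (Suc n)} = insert (- int (Suc n)) (insert (int (Suc n)) {- int n..int n})"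
    by auto
  moreover have "nat ((int (Suc n))\<^sup>2) = (Suc n)\<^sup>2" by (simp add: nat_power_eq)
  moreover have "nat ((- int (Suc n))\<^sup>2) = (Suc n)\<^sup>2" using calculation(2) by (simp only: power2_minus)
  moreover have "nat \<bar>int (Suc n)\<bar> = Suc n" "nat \<bar>- int (Suc n)\<bar> = Suc n" by auto
  ultimately show ?thesis
    unfolding theta_trunc_def
    by (simp del: of_nat_Suc power_Suc add: algebra_simps)
qed

text \<open>Shanks's correction terms: all but the constant one vanish modulo \<open>X\<^sup>n\<^sup>+\<^sup>1\<close>.\<close>

definition shanks_sum :: "nat \<Rightarrow> int fps" where
  "shanks_sum n = 1 + 2 * (\<Sum>s=1..n. (- 1) ^ s * overline_free_fps s * fps_X ^ (s * (n + 1)))"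

text \<open>With F(s) = (-1)^(s+1) X^((s+1)n) \<open>restricted_fps s\<close>, the summand is F(s) -
  F(s-1), and F(0) = -X^n. This becomes visible once \<open>restricted_fps s\<close> and
  \<open>restricted_fps (s - 1)\<close> are both written as multiples of
  \<open>overline_free_fps s\<close>.\<close>

lemma shanks_telescope:
  "(\<Sum>s=1..m. (- 1) ^ s * overline_free_fps s * fps_X ^ (s * n) *
       ((1 - fps_X ^ n) * fps_X ^ s - (1 + fps_X ^ n))) =
   fps_X ^ n + (- 1) ^ Suc m * fps_X ^ (Suc m * n) * restricted_fps m"
proof (induction m)
  case 0
  thus ?case by (simp add: restricted_fps_0)
next
  case (Suc m)
  have 1: "(1 - fps_X ^ Suc m) * overline_free_fps (Suc m) = restricted_fps m"
    using overline_free_fps_eq[of "Suc m"] by simp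
  have 2: "restricted_fps (Suc m) = (1 + fps_X ^ Suc m) * overline_free_fps (Suc m)"
    by (rule restricted_fps_eq) simp
  define h y z w where "h = overline_free_fps (Suc m)" and "y = (fps_X ^ n :: int fps)"
    and "z = (fps_X ^ Suc m :: int fps)" and "w = (fps_X ^ (Suc m * n) :: int fps)"
  have "(\<Sum>s=1..Suc m. (- 1) ^ s * overline_free_fps s * fps_X ^ (s * n) *
       ((1 - fps_X ^ n) * fps_X ^ s - (1 + fps_X ^ n))) =
     fps_X ^ n + (- 1) ^ Suc m * fps_X ^ (Suc m * n) * restricted_fps m
     + (- 1) ^ Suc m * overline_free_fps (Suc m) * fps_X ^ (Suc m * n) *
       ((1 - fps_X ^ n) * fps_X ^ Suc m - (1 + fps_X ^ n))"
    using Suc by (simp del: power_Suc mult_Suc)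
  also have "\<dots> = y + (- 1) ^ Suc m * w * ((1 - z) * h) + (- 1) ^ Suc m * h * w * ((1 - y) * z - (1 + y))"
    unfolding 1[symmetric] h_def y_def z_def w_def by (rule refl)
  also have "\<dots> = y + (- 1) ^ Suc (Suc m) * (y * w) * ((1 + z) * h)"
    by (simp add: algebra_simps)
  also have "y * w = fps_X ^ (Suc (Suc m) * n)"
    by (simp add: y_def w_def power_add)
  finally show ?case unfolding 2 y_def h_def z_def .
qed

text \<open>Raising the bound to \<open>n + 1\<close> multiplies the product by (1 + y)/(1 - y),
  where y = X^(n+1), and adds one pair of terms to the theta sum. Both sides are compared after
  multiplication by 1 - y, which is cancelled at the end.\<close>

lemma shanks_identity: "restricted_fps n * theta_trunc n = shanks_sum n"
proof (induction n)
  case 0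
  thus ?case by (simp add: restricted_fps_0 theta_trunc_0 shanks_sum_def)
next
  case (Suc n)
  define y h where "y = (fps_X ^ Suc n :: int fps)" and "h = overline_free_fps (Suc n)"
  define e where "e = ((- 1) ^ Suc n :: int fps)"
  define sq where "sq = (fps_X ^ (Suc n)\<^sup>2 :: int fps)"
  \<comment> \<open>\<open>S\<close> is the correction sum at stage \<open>n\<close>;
    \<open>T\<close> is the one at stage \<open>n + 1\<close> without its last term s = n + 1. The
    telescoping sum links the two.\<close>
  define S T where "S = (\<Sum>s=1..n. (- 1) ^ s * overline_free_fps s * fps_X ^ (s * (n + 1)))"
    and "T = (\<Sum>s=1..n. (- 1) ^ s * overline_free_fps s * fps_X ^ (s * (n + 1)) * fps_X ^ s)"
  have 1: "(1 - y) * h = restricted_fps n"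
    using overline_free_fps_eq[of "Suc n"] by (simp add: y_def h_def)
  have 2: "restricted_fps (Suc n) = (1 + y) * h"
    unfolding y_def h_def by (rule restricted_fps_eq) simp
  have "(1 - y) * T - (1 + y) * S = (\<Sum>s=1..n. (- 1) ^ s * overline_free_fps s * fps_X ^ (s * Suc n) *
       ((1 - fps_X ^ Suc n) * fps_X ^ s - (1 + fps_X ^ Suc n)))"
    unfolding S_def T_def sum_distrib_left sum_subtractf[symmetric] y_def
    by (intro sum.cong refl) (simp only: Suc_eq_plus1 algebra_simps)
  also have "\<dots> = y + e * sq * restricted_fps n"
    unfolding shanks_telescope y_def e_def sq_def by (simp only: power2_eq_square)
  finally have 3: "(1 - y) * T - (1 + y) * S = y + e * sq * ((1 - y) * h)"
    by (simp add: 1)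
  have IH: "(1 - y) * h * theta_trunc n = 1 + 2 * S"
    using Suc 1 by (simp add: shanks_sum_def S_def)
  have "shanks_sum (Suc n) = 1 + 2 * (T + e * h * (sq * y))"
  proof -
    have "(\<Sum>s=1..Suc n. (- 1) ^ s * overline_free_fps s * fps_X ^ (s * (Suc n + 1))) =
        (\<Sum>s=1..n. (- 1) ^ s * overline_free_fps s * fps_X ^ (s * (Suc n + 1))) +
        e * h * fps_X ^ (Suc n * (Suc n + 1))"
      unfolding e_def h_def by (subst sum.cl_ivl_Suc) simp
    also have "(\<Sum>s=1..n. (- 1) ^ s * overline_free_fps s * fps_X ^ (s * (Suc n + 1))) = T"
      unfolding T_def
    proof (intro sum.cong refl)
      fix s :: nat
      have "s * (Suc n + 1) = s * (n + 1) + s" by simp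
      thus "(- 1) ^ s * overline_free_fps s * fps_X ^ (s * (Suc n + 1)) =
          (- 1) ^ s * overline_free_fps s * fps_X ^ (s * (n + 1)) * fps_X ^ s"
        by (simp only: power_add mult.assoc)
    qed
    also have "Suc n * (Suc n + 1) = (Suc n)\<^sup>2 + Suc n" by (simp add: power2_eq_square)
    hence "(fps_X ^ (Suc n * (Suc n + 1)) :: int fps) = sq * y"
      unfolding sq_def y_def by (simp only: power_add)
    finally show ?thesis unfolding shanks_sum_def by (simp only:)
  qed
  moreover have "(1 - y) * ((1 + y) * h * (theta_trunc n + 2 * e * sq)) =
      (1 - y) * (1 + 2 * (T + e * h * (sq * y)))"
  proof -
    have "(1 - y) * ((1 + y) * h * (theta_trunc n + 2 * e * sq)) =
       (1 + y) * ((1 - y) * h * theta_trunc n) + 2 * (1 + y) * (e * sq * ((1 - y) * h))"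
      by (simp add: algebra_simps)
    also have "\<dots> = (1 + y) * (1 + 2 * S) + 2 * (1 + y) * (e * sq * ((1 - y) * h))"
      by (simp only: IH)
    \<comment> \<open>The subtracted bracket is the difference of the two sides of fact
      \<open>3\<close>, hence zero.\<close>
    also have "\<dots> = (1 - y) * (1 + 2 * (T + e * h * (sq * y)))
        - 2 * ((1 - y) * T - (1 + y) * S - (y + e * sq * ((1 - y) * h)))"
      by (simp add: algebra_simps)
    finally show ?thesis by (simp add: 3)
  qed
  moreover have "1 - y \<noteq> 0"
  proof
    assume "1 - y = 0"
    hence "(1 - y) $ 0 = 0" by simp
    thus False by (simp add: y_def)
  qed
  ultimately show ?case
    unfolding 2 theta_trunc_Suc e_def[symmetric] sq_def[symmetric]
    by (metis mult_left_cancel)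
qed

lemma shanks_sum_nth:
  assumes "N \<le> n"
  shows "shanks_sum n $ N = (if N = 0 then 1 else 0)"
proof -
  define A where "A = (\<Sum>s=1..n. (- 1) ^ s * overline_free_fps s * fps_X ^ (s * (n + 1)))"
  have "((- 1) ^ s * overline_free_fps s * fps_X ^ (s * (n + 1))) $ N = 0" if "s \<in> {1..n}" for s
  proof -
    have "1 * (n + 1) \<le> s * (n + 1)" using that by (intro mult_le_mono1) simp
    hence le: "n + 1 \<le> s * (n + 1)" by (simp only: mult_1)
    have "N < n + 1" using assms by simp
    hence "N < s * (n + 1)" using le by (rule less_le_trans)
    thus ?thesis by (simp only: fps_X_power_mult_right_nth if_True)
  qed
  hence "A $ N = 0"
    unfolding A_def fps_sum_nth by (rule sum.neutral[rule_format])
  moreover have "shanks_sum n = 1 + (A + A)"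
    unfolding shanks_sum_def A_def by (rule arg_cong[OF mult_2])
  ultimately show ?thesis by (simp only: fps_add_nth fps_one_nth add_0_right)
qed

lemma restricted_fps_nth: "N \<le> n \<Longrightarrow> restricted_fps n $ N = int (overpartition_count N)"
  by (simp add: restricted_fps_def restricted_overpartitions_large overpartition_count_def)

section \<open>Theta series and Gauss's identity\<close>

definition signed_fps :: "('a \<Rightarrow> nat) \<Rightarrow> int fps" where
  "signed_fps f = Abs_fps (\<lambda>n. (- 1) ^ n * int (card {x. f x = n}))"

lemma finite_fibre_add:
  fixes f :: "'a \<Rightarrow> nat" and g :: "'b \<Rightarrow> nat"
  assumes "\<And>n. finite {x. f x = n}" "\<And>n. finite {y. g y = n}"
  shows "finite {(x, y). f x + g y = n}"
proof -
  have "{(x, y). f x + g y = n} = (\<Union>i\<in>{0..n}. {x. f x = i} \<times> {y. g y = n - i})"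
    by auto
  thus ?thesis using assms by simp
qed

text \<open>The sign depends on the exponent alone and (-1)^(i+j) = (-1)^i (-1)^j, so the Cauchy
  product counts pairs.\<close>

lemma signed_fps_mult:
  fixes f :: "'a \<Rightarrow> nat" and g :: "'b \<Rightarrow> nat"
  assumes "\<And>n. finite {x. f x = n}" "\<And>n. finite {y. g y = n}"
  shows "signed_fps f * signed_fps g = signed_fps (\<lambda>(x, y). f x + g y)"
proof (rule fps_ext)
  fix n
  have eq: "{z. (case z of (x, y) \<Rightarrow> f x + g y) = n} = (\<Union>i\<in>{0..n}. {x. f x = i} \<times> {y. g y = n - i})"
    by auto
  have "card {z. (case z of (x, y) \<Rightarrow> f x + g y) = n} =
      (\<Sum>i=0..n. card {x. f x = i} * card {y. g y = n - i})"
    unfolding eq using assms by (subst card_UN_disjoint) (auto simp: card_cartesian_product)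
  thus "(signed_fps f * signed_fps g) $ n = signed_fps (\<lambda>(x, y). f x + g y) $ n"
    unfolding signed_fps_def fps_mult_nth
    by (auto simp: sum_distrib_left power_add[symmetric] intro!: sum.cong)
qed

definition square :: "int \<Rightarrow> nat" where "square k = nat (k\<^sup>2)"

definition theta :: "int fps" where "theta = signed_fps square"

lemma square_fibre_subset:
  assumes "N \<le> n"
  shows "{k. square k = N} \<subseteq> {- int n..int n}"
proof
  fix k assume "k \<in> {k. square k = N}"
  hence "k\<^sup>2 = int N" by (auto simp: square_def)
  moreover have "\<bar>k\<bar> \<le> k\<^sup>2"
    using self_le_power[of "\<bar>k\<bar>" 2] by (cases "k = 0") auto
  ultimately have "\<bar>k\<bar> \<le> int n" using assms by linarith
  thus "k \<in> {- int n..int n}" by auto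
qed

lemma finite_square_fibre: "finite {k. square k = n}"
  by (rule finite_subset[OF square_fibre_subset[OF order.refl]]) simp

text \<open>\<open>k\<close> and its square have the same parity, so the sign (-1)^k in Gauss's
  series can be read off from the exponent, as in \<open>signed_fps\<close>.\<close>

lemma minus_one_power_square: "(- 1) ^ square k = ((- 1) ^ nat \<bar>k\<bar> :: 'a :: ring_1)"
proof -
  have "even (square k) = even (nat \<bar>k\<bar>)"
    by (simp add: square_def even_nat_iff)
  thus ?thesis by (simp add: minus_one_power_iff)
qed

lemma theta_trunc_altdef: "theta_trunc n = (\<Sum>k\<in>{- int n..int n}. (- 1) ^ square k * fps_X ^ square k)"
  unfolding theta_trunc_def minus_one_power_square by (simp add: square_def)

lemma theta_trunc_nth:
  assumes "N \<le> n"
  shows "theta_trunc n $ N = theta $ N"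
proof -
  have "theta_trunc n $ N = (\<Sum>k\<in>{- int n..int n}. if square k = N then (- 1) ^ N else 0)"
    unfolding theta_trunc_altdef fps_sum_nth
    by (intro sum.cong refl) (auto simp: fps_X_power_mult_right_nth minus_one_power_iff)
  also have "\<dots> = (\<Sum>k\<in>{k. square k = N}. (- 1) ^ N)"
    using square_fibre_subset[OF assms]
    by (intro sum.mono_neutral_cong_right) auto
  finally show ?thesis by (simp add: theta_def signed_fps_def)
qed

definition overpartition_fps :: "int fps" where
  "overpartition_fps = Abs_fps (\<lambda>n. int (overpartition_count n))"

lemma fps_mult_nth_cong:
  assumes "\<And>i. i \<le> n \<Longrightarrow> a $ i = a' $ i" "\<And>i. i \<le> n \<Longrightarrow> b $ i = b' $ i"
  shows "(a * b) $ n = (a' * b') $ n"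
  unfolding fps_mult_nth using assms by (intro sum.cong) auto

lemma fps_power_nth_cong:
  fixes a a' :: "'a :: comm_ring_1 fps"
  assumes "\<And>i. i \<le> n \<Longrightarrow> a $ i = a' $ i"
  shows "(a ^ k) $ n = (a' ^ k) $ n"
  using assms
proof (induction k arbitrary: n)
  case (Suc k)
  thus ?case unfolding power_Suc by (intro fps_mult_nth_cong) auto
qed auto

text \<open>Coefficient \<open>n\<close> of a product involves only coefficients up to
  \<open>n\<close>, where both factors agree with their truncations at stage \<open>n\<close>. The
  finite identity then leaves 1, since all its corrections start beyond X^n.\<close>

lemma overpartition_fps_mult_theta: "overpartition_fps * theta = 1"
proof (rule fps_ext)
  fix n
  have "(overpartition_fps * theta) $ n = (restricted_fps n * theta_trunc n) $ n"
    by (intro fps_mult_nth_cong) (simp_all add: overpartition_fps_def restricted_fps_nth theta_trunc_nth)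
  thus "(overpartition_fps * theta) $ n = 1 $ n"
    by (simp add: shanks_identity shanks_sum_nth)
qed

section \<open>Fifth powers modulo 5\<close>

lemma sum_power5_cong:
  fixes u :: "'b \<Rightarrow> 'a :: comm_ring_1"
  assumes "finite A"
  shows "5 dvd (sum u A ^ 5 - (\<Sum>k\<in>A. u k ^ 5))"
  using assms
proof (induction A rule: finite_induct)
  case (insert x A)
  define a s where "a = u x" and "s = sum u A"
  have "(a + s) ^ 5 - (a ^ 5 + s ^ 5) = 5 * (a ^ 4 * s + 2 * a ^ 3 * s ^ 2 + 2 * a ^ 2 * s ^ 3 + a * s ^ 4)"
    by (simp add: eval_nat_numeral algebra_simps)
  hence "5 dvd (a + s) ^ 5 - (a ^ 5 + s ^ 5)" by (rule dvdI)
  moreover have "5 dvd s ^ 5 - (\<Sum>k\<in>A. u k ^ 5)" using insert by (simp add: s_def)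
  ultimately have "5 dvd ((a + s) ^ 5 - (a ^ 5 + s ^ 5)) + (s ^ 5 - (\<Sum>k\<in>A. u k ^ 5))"
    by (rule dvd_add)
  thus ?case using insert by (simp add: a_def s_def algebra_simps)
qed simp

text \<open>The Frobenius congruence is applied to the finite sum \<open>theta_trunc n\<close> in
  the ring of power series. The fifth power of a term replaces X by X^5 and keeps the sign, as 5 is
  odd.\<close>

lemma theta_power5_nth:
  "[(theta ^ 5) $ n = (if 5 dvd n then theta $ (n div 5) else 0)] (mod 5)"
proof -
  define S where "S = (\<Sum>k\<in>{- int n..int n}. ((- 1) ^ square k * fps_X ^ square k) ^ 5 :: int fps)"
  have trunc: "theta_trunc n ^ 5 $ n = theta ^ 5 $ n"
    by (intro fps_power_nth_cong) (simp add: theta_trunc_nth)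
  have "5 dvd theta_trunc n ^ 5 - S"
    unfolding theta_trunc_altdef S_def by (rule sum_power5_cong) simp
  then obtain K where "theta_trunc n ^ 5 - S = 5 * K" by (rule dvdE)
  hence K: "theta_trunc n ^ 5 = 5 * K + S" by (simp only: diff_eq_eq)
  have "(5 * K) $ n = 5 * K $ n"
    using fps_mult_left_const_nth[of 5 K n] by (simp only: numeral_fps_const)
  hence "[(theta ^ 5) $ n = S $ n] (mod 5)"
    unfolding trunc[symmetric] K by (simp add: cong_def)
  moreover have "S $ n = (\<Sum>k\<in>{- int n..int n}. (- 1) ^ square k * (fps_X ^ (5 * square k)) $ n)"
    unfolding S_def fps_sum_nth power_mult_distrib power_mult[symmetric]
    by (intro sum.cong) (auto simp: minus_one_power_iff mult.commute)
  moreover have "(\<Sum>k\<in>{- int n..int n}. (- 1) ^ square k * (fps_X ^ (5 * square k)) $ n) =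
      (if 5 dvd n then theta $ (n div 5) else (0::int))"
  proof (cases "5 dvd n")
    case True
    then obtain m where m: "n = 5 * m" by blast
    have "(\<Sum>k\<in>{- int n..int n}. (- 1) ^ square k * (fps_X ^ (5 * square k)) $ n) =
        theta_trunc n $ m"
      unfolding theta_trunc_altdef fps_sum_nth
      by (intro sum.cong) (auto simp: m minus_one_power_iff)
    thus ?thesis by (simp add: m theta_trunc_nth)
  next
    case False
    thus ?thesis by (intro trans[OF sum.neutral]) auto
  qed
  ultimately show ?thesis by simp
qed

section \<open>Double counting of images of similarities\<close>

lemma card_cong_double_counting:
  fixes p :: nat
  assumes "finite S" "finite I" and I: "[card I = 1] (mod p)"
    and bij: "\<And>i. i \<in> I \<Longrightarrow> bij_betw (g i) T {x \<in> S. C i x}"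
    and one: "\<And>x. x \<in> S \<Longrightarrow> [card {i \<in> I. C i x} = 1] (mod p)"
  shows "[card S = card T] (mod p)"
proof -
  \<comment> \<open>The pairs (i, x) with \<open>C i x\<close> are counted in two ways: modulo
    \<open>p\<close>, the sum over x gives \<open>card S\<close> and the sum over i gives
    \<open>card T\<close>.\<close>
  have "(\<Sum>x\<in>S. card {i \<in> I. C i x}) = (\<Sum>i\<in>I. card {x \<in> S. C i x})"
    using sum.swap[of "\<lambda>x i. if C i x then 1 else 0 :: nat" I S] assms(1,2)
    by (simp add: sum.If_cases Int_def)
  also have "\<dots> = (\<Sum>i\<in>I. card T)"
    using bij by (intro sum.cong refl bij_betw_same_card[symmetric])
  also have "\<dots> = card I * card T" by simp
  finally have eq: "(\<Sum>x\<in>S. card {i \<in> I. C i x}) = card I * card T" .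
  have "[(\<Sum>x\<in>S. 1) = (\<Sum>x\<in>S. card {i \<in> I. C i x})] (mod p)"
    using one by (intro cong_sum) (auto intro: cong_sym)
  also have "(\<Sum>x\<in>S. card {i \<in> I. C i x}) = card I * card T" by (rule eq)
  also have "[card I * card T = 1 * card T] (mod p)"
    using I by (rule cong_mult) simp
  finally show ?thesis by simp
qed

text \<open>\<open>B\<close> inverts \<open>A\<close> up to \<open>scale\<close>. If
  \<open>B x = scale z\<close>, then \<open>scale x = A (scale z) = scale (A z)\<close>, so
  \<open>x = A z\<close>: lying in the image of \<open>A\<close> becomes a divisibility condition on
  \<open>B x\<close>.\<close>

lemma bij_betw_similarity:
  fixes N :: "'v \<Rightarrow> 'n :: idom"
  assumes "k \<noteq> 0" "inj scale"
    and "\<And>y. N (A y) = k * N y" "\<And>y. A (scale y) = scale (A y)"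
    and "\<And>x. A (B x) = scale x" "\<And>y. B (A y) = scale y"
  shows "bij_betw A {y. N y = n} {x \<in> {x. N x = k * n}. B x \<in> range scale}"
proof (rule bij_betw_imageI)
  show "inj_on A {y. N y = n}"
    using assms by (metis injD inj_onI)
  show "A ` {y. N y = n} = {x \<in> {x. N x = k * n}. B x \<in> range scale}"
  proof (intro equalityI subsetI)
    fix x assume x: "x \<in> {x \<in> {x. N x = k * n}. B x \<in> range scale}"
    then obtain z where z: "B x = scale z" by auto
    hence "scale x = scale (A z)" using assms(4,5) by metis
    hence "x = A z" using assms(2) by (auto dest: injD)
    moreover have "N z = n" using x assms(1,3) \<open>x = A z\<close> by auto
    ultimately show "x \<in> A ` {y. N y = n}" by auto
  qed (use assms in auto)
qed

section \<open>Quaternions of norm 5\<close>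

text \<open>Pure quaternions \<open>v\<close> of norm 4: up to units, the elements \<open>1 + v\<close> are the
  integral quaternions of norm 5.\<close>

definition axis_vectors :: "(int \<times> int \<times> int) set" where
  "axis_vectors = {(2, 0, 0), (- 2, 0, 0), (0, 2, 0), (0, - 2, 0), (0, 0, 2), (0, 0, - 2)}"

lemma finite_axis_vectors: "finite axis_vectors"
  by (simp add: axis_vectors_def)

lemma card_axis_vectors: "card axis_vectors = 6"
  by (simp add: axis_vectors_def)

lemma card_Collect_axis_vectors:
  "card {v \<in> axis_vectors. P v} = of_bool (P (2, 0, 0)) + of_bool (P (- 2, 0, 0)) + of_bool (P (0, 2, 0))
    + of_bool (P (0, - 2, 0)) + of_bool (P (0, 0, 2)) + of_bool (P (0, 0, - 2))"
proof -
  have "card {v \<in> axis_vectors. P v} = (\<Sum>v\<in>axis_vectors. of_bool (P v))"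
    using finite_axis_vectors by (simp add: of_bool_def sum.If_cases Int_def)
  thus ?thesis by (simp add: axis_vectors_def)
qed

fun neg3 :: "int \<times> int \<times> int \<Rightarrow> int \<times> int \<times> int" where
  "neg3 (p, q, r) = (- p, - q, - r)"

fun scale3 :: "int \<Rightarrow> int \<times> int \<times> int \<Rightarrow> int \<times> int \<times> int" where
  "scale3 k (a, b, c) = (k * a, k * b, k * c)"

fun scale4 :: "int \<Rightarrow> int \<times> int \<times> int \<times> int \<Rightarrow> int \<times> int \<times> int \<times> int" where
  "scale4 k (a, b, c, d) = (k * a, k * b, k * c, k * d)"

fun norm3 :: "int \<times> int \<times> int \<Rightarrow> int" where
  "norm3 (a, b, c) = a\<^sup>2 + b\<^sup>2 + c\<^sup>2"

fun norm4 :: "int \<times> int \<times> int \<times> int \<Rightarrow> int" where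
  "norm4 (a, b, c, d) = a\<^sup>2 + b\<^sup>2 + c\<^sup>2 + d\<^sup>2"

text \<open>Right multiplication of \<open>a + b i + c j + d k\<close> by \<open>1 + v\<close>.\<close>

fun quat_mult :: "int \<times> int \<times> int \<Rightarrow> int \<times> int \<times> int \<times> int \<Rightarrow> int \<times> int \<times> int \<times> int" where
  "quat_mult (p, q, r) (a, b, c, d) =
     (a - b * p - c * q - d * r, b + a * p + c * r - d * q,
      c + a * q + d * p - b * r, d + a * r + b * q - c * p)"

text \<open>Conjugation \<open>y \<mapsto> (1 + v) y (1 - v)\<close> of pure quaternions, that is
  \<open>- 3 y + 2 (v \<bullet> y) v + 2 (v \<times> y)\<close>: it is 5 times a rotation.\<close>

fun quat_conj :: "int \<times> int \<times> int \<Rightarrow> int \<times> int \<times> int \<Rightarrow> int \<times> int \<times> int" where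
  "quat_conj (p, q, r) (a, b, c) =
     (- 3 * a + 2 * (p * a + q * b + r * c) * p + 2 * (q * c - r * b),
      - 3 * b + 2 * (p * a + q * b + r * c) * q + 2 * (r * a - p * c),
      - 3 * c + 2 * (p * a + q * b + r * c) * r + 2 * (p * b - q * a))"

lemma inj_scale: "k \<noteq> 0 \<Longrightarrow> inj (scale3 k)" "k \<noteq> 0 \<Longrightarrow> inj (scale4 k)"
  by (auto simp: inj_def)

lemma range_scale3: "(a, b, c) \<in> range (scale3 k) \<longleftrightarrow> k dvd a \<and> k dvd b \<and> k dvd c"
  by (force simp: image_iff dvd_def)

lemma range_scale4: "(a, b, c, d) \<in> range (scale4 k) \<longleftrightarrow> k dvd a \<and> k dvd b \<and> k dvd c \<and> k dvd d"
  by (force simp: image_iff dvd_def)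

text \<open>Since v^2 = -4, (1 + v)(1 - v) = 5. Hence right multiplication by 1 - v inverts right
  multiplication by 1 + v up to the factor 5.\<close>

lemma quat_mult_bij:
  assumes "v \<in> axis_vectors"
  shows "bij_betw (quat_mult v) {y. norm4 y = n}
    {x \<in> {x. norm4 x = 5 * n}. quat_mult (neg3 v) x \<in> range (scale4 5)}"
proof (rule bij_betw_similarity)
  fix y :: "int \<times> int \<times> int \<times> int"
  obtain a b c d where [simp]: "y = (a, b, c, d)" by (cases y)
  show "norm4 (quat_mult v y) = 5 * norm4 y"
    using assms by (auto simp: axis_vectors_def power2_eq_square algebra_simps)
  show "quat_mult v (scale4 5 y) = scale4 5 (quat_mult v y)"
    using assms by (auto simp: axis_vectors_def)
  show "quat_mult v (quat_mult (neg3 v) y) = scale4 5 y" "quat_mult (neg3 v) (quat_mult v y) = scale4 5 y"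
    using assms by (auto simp: axis_vectors_def)
qed (use inj_scale in auto)

text \<open>Conjugating by 1 + v and then by 1 - v produces a factor 5 on either side, hence 25 in
  total.\<close>

lemma quat_conj_bij:
  assumes "v \<in> axis_vectors"
  shows "bij_betw (quat_conj v) {y. norm3 y = n}
    {x \<in> {x. norm3 x = 25 * n}. quat_conj (neg3 v) x \<in> range (scale3 25)}"
proof (rule bij_betw_similarity)
  fix y :: "int \<times> int \<times> int"
  obtain a b c where [simp]: "y = (a, b, c)" by (cases y)
  show "norm3 (quat_conj v y) = 25 * norm3 y"
    using assms by (auto simp: axis_vectors_def power2_eq_square algebra_simps)
  show "quat_conj v (scale3 25 y) = scale3 25 (quat_conj v y)"
    using assms by (auto simp: axis_vectors_def)
  show "quat_conj v (quat_conj (neg3 v) y) = scale3 25 y" "quat_conj (neg3 v) (quat_conj v y) = scale3 25 y"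
    using assms by (auto simp: axis_vectors_def)
qed (use inj_scale in auto)

section \<open>Divisors of a vector among the six quaternions\<close>

text \<open>The summands express that \<open>x (1 - v)\<close> is divisible by 5, for \<open>v\<close> running through
  \<open>axis_vectors\<close>; they only depend on residues modulo 5, so a finite check applies.\<close>

definition divisor_count4 :: "int \<Rightarrow> int \<Rightarrow> int \<Rightarrow> int \<Rightarrow> nat" where
  "divisor_count4 a b c d =
     of_bool (5 dvd a + 2 * b \<and> 5 dvd b - 2 * a \<and> 5 dvd c - 2 * d \<and> 5 dvd d + 2 * c) +
     of_bool (5 dvd a - 2 * b \<and> 5 dvd b + 2 * a \<and> 5 dvd c + 2 * d \<and> 5 dvd d - 2 * c) +
     of_bool (5 dvd a + 2 * c \<and> 5 dvd b + 2 * d \<and> 5 dvd c - 2 * a \<and> 5 dvd d - 2 * b) +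
     of_bool (5 dvd a - 2 * c \<and> 5 dvd b - 2 * d \<and> 5 dvd c + 2 * a \<and> 5 dvd d + 2 * b) +
     of_bool (5 dvd a + 2 * d \<and> 5 dvd b - 2 * c \<and> 5 dvd c + 2 * b \<and> 5 dvd d - 2 * a) +
     of_bool (5 dvd a - 2 * d \<and> 5 dvd b + 2 * c \<and> 5 dvd c - 2 * b \<and> 5 dvd d + 2 * a)"

lemma dvd_mod_int:
  fixes a b k m :: int
  shows "m dvd a + k * b \<longleftrightarrow> m dvd a mod m + k * (b mod m)"
    "m dvd a - k * b \<longleftrightarrow> m dvd a mod m - k * (b mod m)"
proof -
  have "[a + k * b = a mod m + k * (b mod m)] (mod m)" "[a - k * b = a mod m - k * (b mod m)] (mod m)"
    by (intro cong_add cong_diff cong_mult cong_refl; simp add: cong_def)+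
  thus "m dvd a + k * b \<longleftrightarrow> m dvd a mod m + k * (b mod m)"
    "m dvd a - k * b \<longleftrightarrow> m dvd a mod m - k * (b mod m)"
    using cong_dvd_iff by blast+
qed

lemma divisor_count4_mod: "divisor_count4 a b c d = divisor_count4 (a mod 5) (b mod 5) (c mod 5) (d mod 5)"
  unfolding divisor_count4_def dvd_mod_int[of 5 a] dvd_mod_int[of 5 b] dvd_mod_int[of 5 c] dvd_mod_int[of 5 d]
  by (rule refl)

lemma mod_5_set: "(a::int) mod 5 \<in> set [0, 1, 2, 3, 4]"
proof -
  have "0 \<le> a mod 5" "a mod 5 < 5" by simp_all
  thus ?thesis by auto
qed

lemma mod_square_cong: "[(a mod m) * (a mod m) = a\<^sup>2] (mod m)" for a m :: int
  unfolding power2_eq_square by (intro cong_mult) (simp_all add: cong_def)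

lemma dvd_mod_squares3:
  fixes a b c m :: int
  shows "m dvd (a mod m) * (a mod m) + (b mod m) * (b mod m) + (c mod m) * (c mod m) \<longleftrightarrow>
    m dvd a\<^sup>2 + b\<^sup>2 + c\<^sup>2"
  by (intro cong_dvd_iff cong_add mod_square_cong)

lemma dvd_mod_squares4:
  fixes a b c d m :: int
  shows "m dvd (a mod m) * (a mod m) + (b mod m) * (b mod m) + (c mod m) * (c mod m) + (d mod m) * (d mod m) \<longleftrightarrow>
    m dvd a\<^sup>2 + b\<^sup>2 + c\<^sup>2 + d\<^sup>2"
  by (intro cong_dvd_iff cong_add mod_square_cong)

text \<open>Modulo 5 the quaternions become 2 x 2 matrices, and x = a + b i + c j + d k becomes
  singular. The column spaces of the six 1 - v are the six lines of the plane over F_5, so x (1 - v)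
  vanishes for exactly one v if x is nonzero, and for all six if x is zero. The proof checks the 625
  residue vectors.\<close>

lemma divisor_count4_cong:
  assumes "5 dvd a\<^sup>2 + b\<^sup>2 + c\<^sup>2 + d\<^sup>2"
  shows "divisor_count4 a b c d mod 5 = 1"
proof -
  have "\<forall>a\<in>set [0, 1, 2, 3, 4]. \<forall>b\<in>set [0, 1, 2, 3, 4]. \<forall>c\<in>set [0, 1, 2, 3, 4]. \<forall>d\<in>set [0, 1, 2, 3, 4].
      5 dvd a * a + b * b + c * c + d * d \<longrightarrow> divisor_count4 a b c d mod 5 = 1"
    by code_simp
  from this[rule_format, OF mod_5_set mod_5_set mod_5_set mod_5_set, of a b c d] show ?thesis
    unfolding dvd_mod_squares4 divisor_count4_mod[of a b c d, symmetric] using assms by blast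
qed

lemma card_quat_mult_divisors:
  assumes "5 dvd norm4 x"
  shows "[card {v \<in> axis_vectors. quat_mult (neg3 v) x \<in> range (scale4 5)} = 1] (mod 5)"
proof -
  obtain a b c d where x: "x = (a, b, c, d)" by (cases x)
  have "card {v \<in> axis_vectors. quat_mult (neg3 v) x \<in> range (scale4 5)} = divisor_count4 a b c d"
    unfolding card_Collect_axis_vectors x divisor_count4_def
    by (simp add: range_scale4 mult.commute)
  thus ?thesis using divisor_count4_cong[of a b c d] assms by (simp add: x cong_def)
qed

text \<open>Divisibility of \<open>(1 - v) x (1 + v)\<close> by 25, where the two conditions modulo 25 are
  combined into one: \<open>7\<close> is a square root of \<open>- 1\<close> modulo 25.\<close>

definition divisor_count3 :: "int \<Rightarrow> int \<Rightarrow> int \<Rightarrow> nat" where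
  "divisor_count3 a b c =
     of_bool (5 dvd a \<and> 25 dvd b + 7 * c) + of_bool (5 dvd a \<and> 25 dvd b - 7 * c) +
     of_bool (5 dvd b \<and> 25 dvd c + 7 * a) + of_bool (5 dvd b \<and> 25 dvd c - 7 * a) +
     of_bool (5 dvd c \<and> 25 dvd a + 7 * b) + of_bool (5 dvd c \<and> 25 dvd a - 7 * b)"

lemma divisor_count3_rotate: "divisor_count3 a b c = divisor_count3 b c a"
  by (simp add: divisor_count3_def)

text \<open>25 divides (b + 7c)(b - 7c) = b^2 + c^2 - 50 c^2. The factors add up to 2b, which is
  prime to 5, so 25 divides exactly one of them. The four other conditions fail because 5 divides
  neither b nor c.\<close>

lemma divisor_count3_cong_nonzero:
  assumes "25 dvd a\<^sup>2 + b\<^sup>2 + c\<^sup>2" "5 dvd a" "\<not> 5 dvd b"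
  shows "divisor_count3 a b c = 1"
proof -
  have "25 dvd a\<^sup>2" using dvd_power_same[OF assms(2), of 2] by simp
  hence bc: "25 dvd b\<^sup>2 + c\<^sup>2" using assms(1) by (simp add: add.assoc dvd_add_right_iff)
  have "5 dvd b\<^sup>2 + c\<^sup>2" using bc by (rule dvd_trans[rotated]) simp
  have p5: "prime (5::int)" by simp
  have c: "\<not> 5 dvd c"
  proof
    assume "5 dvd c"
    hence "5 dvd c\<^sup>2" by (simp add: power2_eq_square)
    with \<open>5 dvd b\<^sup>2 + c\<^sup>2\<close> have "5 dvd b\<^sup>2" by (simp add: dvd_add_left_iff)
    thus False using assms(3) p5 prime_dvd_power by blast
  qed
  have "(b + 7 * c) * (b - 7 * c) = b\<^sup>2 + c\<^sup>2 - 25 * (2 * c\<^sup>2)"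
    by (simp add: power2_eq_square algebra_simps)
  hence prod: "25 dvd (b + 7 * c) * (b - 7 * c)"
    using bc by (metis dvd_diff dvd_triv_left)
  have not_both: "\<not> (5 dvd b + 7 * c \<and> 5 dvd b - 7 * c)"
    using assms(3) by presburger
  have *: "25 dvd y" if "25 dvd x * y" "\<not> 5 dvd x" for x y :: int
  proof -
    have "coprime (5 ^ 2) x" using prime_imp_coprime[OF p5 that(2)] by (rule coprime_power_left_iff[THEN iffD2, OF disjI1])
    thus ?thesis using that(1) coprime_dvd_mult_right_iff[of "5 ^ 2" x y] by simp
  qed
  have "5 dvd (b + 7 * c) * (b - 7 * c)" using prod by (rule dvd_trans[rotated]) simp
  hence "5 dvd b + 7 * c \<or> 5 dvd b - 7 * c" using p5 by (simp add: prime_dvd_mult_iff)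
  moreover have "25 dvd b - 7 * c" if "\<not> 5 dvd b + 7 * c" using *[OF prod that] .
  moreover have "25 dvd b + 7 * c" if "\<not> 5 dvd b - 7 * c"
    using * prod that by (simp only: mult.commute[of "b + 7 * c"])
  moreover have "5 dvd z" if "25 dvd z" for z :: int using that by (rule dvd_trans[rotated]) simp
  ultimately have "25 dvd b + 7 * c \<longleftrightarrow> \<not> 25 dvd b - 7 * c"
    using not_both by blast
  thus ?thesis using assms(2,3) c by (auto simp: divisor_count3_def)
qed

text \<open>The value of \<open>divisor_count3\<close> at \<open>(5 * a, 5 * b, 5 * c)\<close>: the
  conditions modulo 5 become vacuous, and those modulo 25 turn into conditions modulo 5.\<close>

definition small_divisor_count3 :: "int \<Rightarrow> int \<Rightarrow> int \<Rightarrow> nat" where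
  "small_divisor_count3 a b c =
     of_bool (5 dvd b + 7 * c) + of_bool (5 dvd b - 7 * c) +
     of_bool (5 dvd c + 7 * a) + of_bool (5 dvd c - 7 * a) +
     of_bool (5 dvd a + 7 * b) + of_bool (5 dvd a - 7 * b)"

lemma small_divisor_count3_mod: "small_divisor_count3 a b c = small_divisor_count3 (a mod 5) (b mod 5) (c mod 5)"
  unfolding small_divisor_count3_def dvd_mod_int[of 5 a] dvd_mod_int[of 5 b] dvd_mod_int[of 5 c]
  by (rule refl)

text \<open>The zero vector modulo 5 satisfies all six conditions. Any other one has exactly one
  zero coordinate, the nonzero squares being 1 and -1, and satisfies exactly one condition.\<close>

lemma small_divisor_count3_cong:
  assumes "5 dvd a\<^sup>2 + b\<^sup>2 + c\<^sup>2"
  shows "small_divisor_count3 a b c mod 5 = 1"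
proof -
  have "\<forall>a\<in>set [0, 1, 2, 3, 4]. \<forall>b\<in>set [0, 1, 2, 3, 4]. \<forall>c\<in>set [0, 1, 2, 3, 4].
      5 dvd a * a + b * b + c * c \<longrightarrow> small_divisor_count3 a b c mod 5 = 1"
    by code_simp
  from this[rule_format, OF mod_5_set mod_5_set mod_5_set, of a b c] show ?thesis
    unfolding dvd_mod_squares3 small_divisor_count3_mod[of a b c, symmetric] using assms by blast
qed

text \<open>If 5 divides all coordinates, the norm of the quotient is still divisible by 5; this is
  what 125 provides. Otherwise exactly one coordinate is divisible by 5, and a cyclic rotation moves
  it to the front.\<close>

lemma divisor_count3_cong:
  assumes "125 dvd a\<^sup>2 + b\<^sup>2 + c\<^sup>2"
  shows "divisor_count3 a b c mod 5 = 1"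
proof (cases "5 dvd a \<and> 5 dvd b \<and> 5 dvd c")
  case True
  then obtain x y z where xyz: "a = 5 * x" "b = 5 * y" "c = 5 * z" by (auto simp: dvd_def)
  have "5 dvd u + v + w" if "125 dvd 25 * u + 25 * v + 25 * w" for u v w :: int
    using that by presburger
  moreover have "125 dvd 25 * x\<^sup>2 + 25 * y\<^sup>2 + 25 * z\<^sup>2"
    using assms by (simp add: xyz power_mult_distrib)
  ultimately have "5 dvd x\<^sup>2 + y\<^sup>2 + z\<^sup>2" by blast
  moreover have "25 dvd 5 * u + 7 * (5 * w) \<longleftrightarrow> 5 dvd u + 7 * w"
    "25 dvd 5 * u - 7 * (5 * w) \<longleftrightarrow> 5 dvd u - 7 * w" for u w :: int
    by presburger+
  hence "divisor_count3 a b c = small_divisor_count3 x y z"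
    by (simp add: divisor_count3_def small_divisor_count3_def xyz)
  ultimately show ?thesis by (simp add: small_divisor_count3_cong)
next
  case False
  have 25: "25 dvd a\<^sup>2 + b\<^sup>2 + c\<^sup>2" using assms by (rule dvd_trans[rotated]) simp
  hence "5 dvd a\<^sup>2 + b\<^sup>2 + c\<^sup>2" by (rule dvd_trans[rotated]) simp
  hence "5 dvd (a mod 5) * (a mod 5) + (b mod 5) * (b mod 5) + (c mod 5) * (c mod 5)"
    by (simp only: dvd_mod_squares3)
  moreover have "\<forall>a\<in>set [0, 1, 2, 3, 4]. \<forall>b\<in>set [0, 1, 2, 3, 4]. \<forall>c\<in>set [0, 1, 2, 3, 4::int].
      5 dvd a * a + b * b + c * c \<longrightarrow>
       (a = 0 \<and> b = 0 \<and> c = 0) \<or> (a = 0 \<and> b \<noteq> 0) \<or> (b = 0 \<and> c \<noteq> 0) \<or> (c = 0 \<and> a \<noteq> 0)"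
    by code_simp
  ultimately have "(a mod 5 = 0 \<and> b mod 5 \<noteq> 0) \<or> (b mod 5 = 0 \<and> c mod 5 \<noteq> 0) \<or> (c mod 5 = 0 \<and> a mod 5 \<noteq> 0)"
    using mod_5_set False by (metis dvd_eq_mod_eq_0)
  then consider "5 dvd a" "\<not> 5 dvd b" | "5 dvd b" "\<not> 5 dvd c" | "5 dvd c" "\<not> 5 dvd a"
    unfolding dvd_eq_mod_eq_0 by metis
  hence "divisor_count3 a b c = 1"
  proof cases
    case 1
    thus ?thesis using divisor_count3_cong_nonzero[of a b c] 25 by simp
  next
    case 2
    thus ?thesis using divisor_count3_cong_nonzero[of b c a] 25
      by (simp add: divisor_count3_rotate[of a b c] add_ac)
  next
    case 3
    thus ?thesis using divisor_count3_cong_nonzero[of c a b] 25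
      by (simp add: divisor_count3_rotate[of c a b] add_ac)
  qed
  thus ?thesis by simp
qed

lemma card_quat_conj_divisors:
  assumes "125 dvd norm3 x"
  shows "[card {v \<in> axis_vectors. quat_conj (neg3 v) x \<in> range (scale3 25)} = 1] (mod 5)"
proof -
  obtain a b c where x: "x = (a, b, c)" by (cases x)
  \<comment> \<open>Along the axis of v the conjugation multiplies by -3 + 8 = 5.\<close>
  have *: "25 dvd 5 * u \<longleftrightarrow> 5 dvd u" for u :: int by presburger
  \<comment> \<open>Modulo 25 the two forms are -3 and -4 times u + 7w, and their difference is
    exactly u + 7w.\<close>
  have rot: "25 dvd - 3 * u + 4 * w \<and> 25 dvd - 3 * w - 4 * u \<longleftrightarrow> 25 dvd u + 7 * w" for u w :: int
  proof
    assume "25 dvd - 3 * u + 4 * w \<and> 25 dvd - 3 * w - 4 * u"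
    hence "25 dvd (- 3 * u + 4 * w) - (- 3 * w - 4 * u)" by (blast intro: dvd_diff)
    thus "25 dvd u + 7 * w" by (simp add: add.commute)
  next
    assume "25 dvd u + 7 * w"
    then obtain k where "u + 7 * w = 25 * k" by (rule dvdE)
    hence "u = 25 * k - 7 * w" by simp
    hence "- 3 * u + 4 * w = 25 * (w - 3 * k)" "- 3 * w - 4 * u = 25 * (w - 4 * k)" by simp_all
    thus "25 dvd - 3 * u + 4 * w \<and> 25 dvd - 3 * w - 4 * u" by (simp only: dvd_triv_left simp_thms)
  qed
  have rot': "25 dvd - 3 * u - 4 * w \<and> 25 dvd - 3 * w + 4 * u \<longleftrightarrow> 25 dvd u - 7 * w" for u w :: int
    using rot[of u "- w"] dvd_minus_iff[of 25 "- 3 * w + 4 * u"] by simp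
  have "card {v \<in> axis_vectors. quat_conj (neg3 v) x \<in> range (scale3 25)} = divisor_count3 a b c"
    unfolding card_Collect_axis_vectors x divisor_count3_def rot[symmetric] rot'[symmetric] *[symmetric]
    by (simp add: range_scale3 conj_ac algebra_simps)
  thus ?thesis using divisor_count3_cong[of a b c] assms by (simp add: x cong_def)
qed

section \<open>Sums of three and four squares\<close>

lemma int_square: "int (square k) = k\<^sup>2"
  by (simp add: square_def)

lemma theta_power3: "theta ^ 3 = Abs_fps (\<lambda>n. (- 1) ^ n * int (card {x. norm3 x = int n}))"
  and finite_norm3: "finite {x. norm3 x = int n}"
  and theta_power4: "theta ^ 4 = Abs_fps (\<lambda>n. (- 1) ^ n * int (card {x. norm4 x = int n}))"
  and finite_norm4: "finite {x. norm4 x = int n}"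
proof -
  \<comment> \<open>Pairs are nested to the right, so that the domains of \<open>f3\<close> and
    \<open>f4\<close> are the tuple types of \<open>norm3\<close> and \<open>norm4\<close>.\<close>
  define f2 where "f2 = (\<lambda>(x, y). square x + square y)"
  define f3 where "f3 = (\<lambda>(x, y). square x + f2 y)"
  define f4 where "f4 = (\<lambda>(x, y). square x + f3 y)"
  have fin2: "finite {x. f2 x = n}" for n
    unfolding f2_def using finite_fibre_add[of square square n] finite_square_fibre by (simp add: case_prod_unfold)
  have fin3: "finite {x. f3 x = n}" for n
    unfolding f3_def using finite_fibre_add[of square f2 n] finite_square_fibre fin2 by (simp add: case_prod_unfold)
  have fin4: "finite {x. f4 x = n}" for n
    unfolding f4_def using finite_fibre_add[of square f3 n] finite_square_fibre fin3 by (simp add: case_prod_unfold)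
  have t2: "theta * theta = signed_fps f2"
    unfolding theta_def f2_def by (intro signed_fps_mult finite_square_fibre)
  have "theta ^ 3 = theta * (theta * theta)" by (simp only: power3_eq_cube mult.assoc)
  hence t3: "theta ^ 3 = signed_fps f3"
    unfolding t2 unfolding theta_def f3_def
    by (simp only: signed_fps_mult finite_square_fibre fin2)
  have "theta ^ 4 = theta * theta ^ 3" by (simp add: eval_nat_numeral)
  hence t4: "theta ^ 4 = signed_fps f4"
    unfolding t3 unfolding theta_def f4_def
    by (simp only: signed_fps_mult finite_square_fibre fin3)
  have n3: "f3 x = n \<longleftrightarrow> norm3 x = int n" for x n
  proof -
    have "int (f3 x) = norm3 x" by (cases x) (simp add: f3_def f2_def int_square)
    thus ?thesis by auto
  qed
  have n4: "f4 x = n \<longleftrightarrow> norm4 x = int n" for x n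
  proof -
    have "int (f4 x) = norm4 x" by (cases x) (simp add: f4_def f3_def f2_def int_square)
    thus ?thesis by auto
  qed
  show "theta ^ 3 = Abs_fps (\<lambda>n. (- 1) ^ n * int (card {x. norm3 x = int n}))"
    unfolding t3 signed_fps_def n3 ..
  show "finite {x. norm3 x = int n}" using fin3[of n] unfolding n3 .
  show "theta ^ 4 = Abs_fps (\<lambda>n. (- 1) ^ n * int (card {x. norm4 x = int n}))"
    unfolding t4 signed_fps_def n4 ..
  show "finite {x. norm4 x = int n}" using fin4[of n] unfolding n4 .
qed

lemma card_norm4_cong: "[card {x. norm4 x = int (5 * n)} = card {x. norm4 x = int n}] (mod 5)"
proof (rule card_cong_double_counting)
  show "finite {x. norm4 x = int (5 * n)}" by (rule finite_norm4)
  show "[card axis_vectors = 1] (mod 5)" by (simp add: card_axis_vectors cong_def)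
  show "bij_betw (quat_mult v) {y. norm4 y = int n}
    {x \<in> {x. norm4 x = int (5 * n)}. quat_mult (neg3 v) x \<in> range (scale4 5)}" if "v \<in> axis_vectors" for v
    using quat_mult_bij[OF that, of "int n"] by simp
  show "[card {v \<in> axis_vectors. quat_mult (neg3 v) x \<in> range (scale4 5)} = 1] (mod 5)"
    if "x \<in> {x. norm4 x = int (5 * n)}" for x
    using that by (intro card_quat_mult_divisors) simp
qed (rule finite_axis_vectors)

text \<open>With \<open>5 dvd n\<close> the target norm 25n is a multiple of 125, as the divisor
  count demands.\<close>

lemma card_norm3_cong:
  assumes "5 dvd n"
  shows "[card {x. norm3 x = int (25 * n)} = card {x. norm3 x = int n}] (mod 5)"
proof (rule card_cong_double_counting)
  show "finite {x. norm3 x = int (25 * n)}" by (rule finite_norm3)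
  show "[card axis_vectors = 1] (mod 5)" by (simp add: card_axis_vectors cong_def)
  show "bij_betw (quat_conj v) {y. norm3 y = int n}
    {x \<in> {x. norm3 x = int (25 * n)}. quat_conj (neg3 v) x \<in> range (scale3 25)}" if "v \<in> axis_vectors" for v
    using quat_conj_bij[OF that, of "int n"] by simp
  show "[card {v \<in> axis_vectors. quat_conj (neg3 v) x \<in> range (scale3 25)} = 1] (mod 5)"
    if "x \<in> {x. norm3 x = int (25 * n)}" for x
    using that assms by (intro card_quat_conj_divisors) (auto elim!: dvdE)
qed (rule finite_axis_vectors)

lemma theta_power4_nth_cong: "[(theta ^ 4) $ (5 * n) = (theta ^ 4) $ n] (mod 5)"
proof -
  have "[int (card {x. norm4 x = int (5 * n)}) = int (card {x. norm4 x = int n})] (mod int 5)"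
    using card_norm4_cong by (simp only: cong_int_iff)
  hence "[(- 1) ^ n * int (card {x. norm4 x = int (5 * n)}) = (- 1) ^ n * int (card {x. norm4 x = int n})] (mod 5)"
    by (intro cong_mult) simp_all
  thus ?thesis
    by (simp add: theta_power4 minus_one_power_iff)
qed

section \<open>The congruence for overpartition counts\<close>

lemma fps_mult_nth_cong_mod:
  fixes a b c :: "int fps"
  assumes "\<And>i. [a $ i = b $ i] (mod m)"
  shows "[(a * c) $ n = (b * c) $ n] (mod m)"
  unfolding fps_mult_nth using assms by (intro cong_sum cong_mult) auto

lemma overpartition_count_5_cong: "[int (overpartition_count (5 * n)) = (theta ^ 3) $ n] (mod 5)"
proof -
  define U where "U = Abs_fps (\<lambda>n. overpartition_fps $ (5 * n))"
  have "[(U * theta) $ N = (theta ^ 4) $ N] (mod 5)" for N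
  proof -
    \<comment> \<open>\<open>?t\<close> lists the coefficients of theta(q^5). It vanishes off the
      multiples of 5, so in the coefficient of q^(5N) only the j divisible by 5 survive.\<close>
    let ?t = "\<lambda>n. if 5 dvd n then theta $ (n div 5) else 0"
    have "(\<Sum>j=0..5 * N. overpartition_fps $ j * ?t (5 * N - j)) =
        (\<Sum>j\<in>(*) 5 ` {0..N}. overpartition_fps $ j * ?t (5 * N - j))"
    proof (rule sum.mono_neutral_right)
      show "\<forall>j\<in>{0..5 * N} - (*) 5 ` {0..N}. overpartition_fps $ j * ?t (5 * N - j) = 0"
      proof
        fix j assume j: "j \<in> {0..5 * N} - (*) 5 ` {0..N}"
        have "\<not> 5 dvd 5 * N - j"
        proof
          assume "5 dvd 5 * N - j"
          moreover have "j \<le> 5 * N" using j by simp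
          ultimately have "5 dvd j" by (meson dvd_diffD1 dvd_triv_left)
          then obtain i where "j = 5 * i" by (rule dvdE)
          with j show False by (auto simp: image_iff)
        qed
        thus "overpartition_fps $ j * ?t (5 * N - j) = 0" by simp
      qed
    qed auto
    also have "\<dots> = (U * theta) $ N"
      by (subst sum.reindex) (auto simp: inj_on_def U_def fps_mult_nth simp flip: diff_mult_distrib2)
    finally have "(U * theta) $ N = (\<Sum>j=0..5 * N. overpartition_fps $ j * ?t (5 * N - j))" ..
    also have "[\<dots> = (\<Sum>j=0..5 * N. overpartition_fps $ j * (theta ^ 5) $ (5 * N - j))] (mod 5)"
      by (intro cong_sum cong_mult cong_refl cong_sym[OF theta_power5_nth])
    also have "(\<Sum>j=0..5 * N. overpartition_fps $ j * (theta ^ 5) $ (5 * N - j)) =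
        (overpartition_fps * theta ^ 5) $ (5 * N)" by (simp add: fps_mult_nth)
    also have "overpartition_fps * theta ^ 5 = (overpartition_fps * theta) * theta ^ 4"
      by (simp add: eval_nat_numeral mult.assoc)
    also have "\<dots> = theta ^ 4" by (simp add: overpartition_fps_mult_theta)
    also have "[(theta ^ 4) $ (5 * N) = (theta ^ 4) $ N] (mod 5)" by (rule theta_power4_nth_cong)
    finally show ?thesis .
  qed
  \<comment> \<open>\<open>overpartition_fps\<close> inverts \<open>theta\<close> over the integers,
    so multiplying by it cancels one factor \<open>theta\<close> on each side of the
    congruence.\<close>
  hence "[(U * theta * overpartition_fps) $ n = (theta ^ 4 * overpartition_fps) $ n] (mod 5)"
    by (rule fps_mult_nth_cong_mod)
  moreover have "U * theta * overpartition_fps = U * (overpartition_fps * theta)"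
    by (simp add: mult_ac)
  moreover have "theta ^ 4 * overpartition_fps = theta ^ 3 * (overpartition_fps * theta)"
    by (simp add: eval_nat_numeral mult_ac)
  ultimately have "[U $ n = (theta ^ 3) $ n] (mod 5)"
    by (simp only: overpartition_fps_mult_theta mult_1_right)
  thus ?thesis by (simp add: U_def overpartition_fps_def)
qed

theorem theorem1p5:
  fixes n :: nat
  shows "overpartition_count (5^2 * n) mod 5 = overpartition_count (5^4 * n) mod 5"
proof -
  \<comment> \<open>125n is 25 times 5n, and 5n is a multiple of 5. The signs (-1)^(125n) and
    (-1)^(5n) both equal (-1)^n, as 125 and 5 are odd.\<close>
  have r: "[int (card {x. norm3 x = int (25 * (5 * n))}) = int (card {x. norm3 x = int (5 * n)})] (mod int 5)"
    using card_norm3_cong[of "5 * n"] by (simp only: cong_int_iff) simp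
  have "[int (overpartition_count (5 ^ 4 * n)) = (theta ^ 3) $ (125 * n)] (mod 5)"
    using overpartition_count_5_cong[of "125 * n"] by simp
  also have "(theta ^ 3) $ (125 * n) = (- 1) ^ n * int (card {x. norm3 x = int (25 * (5 * n))})"
    by (simp add: theta_power3 minus_one_power_iff)
  also have "[\<dots> = (- 1) ^ n * int (card {x. norm3 x = int (5 * n)})] (mod 5)"
    using r by (intro cong_mult) simp_all
  also have "(- 1) ^ n * int (card {x. norm3 x = int (5 * n)}) = (theta ^ 3) $ (5 * n)"
    by (simp add: theta_power3 minus_one_power_iff)
  also have "[\<dots> = int (overpartition_count (5 ^ 2 * n))] (mod 5)"
    using overpartition_count_5_cong[of "5 * n"] by (simp add: cong_sym_eq)
  finally have "[int (overpartition_count (5 ^ 4 * n)) = int (overpartition_count (5 ^ 2 * n))] (mod int 5)"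
    by simp
  hence "[overpartition_count (5 ^ 4 * n) = overpartition_count (5 ^ 2 * n)] (mod 5)"
    by (simp only: cong_int_iff)
  thus ?thesis unfolding cong_def by (rule sym)
qed

end
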